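(* Let $K$ be a field of prime characteristic $p$, $G$ a finite group and $V$ a (finite-dimensional) permutation $KG$-module. Then for any $2\leq r\leq p-1$ the surjective map $\partial_r: \operatorname{Sym}^r V \to \operatorname{Sym}^{r-1} V$ splits, that is, there is a $KG$-module homomorphism $\phi:\operatorname{Sym}^{r-1}V\to \operatorname{Sym}^rV$ with $\partial_r\circ\phi=\operatorname{id}$. In particular, $\operatorname{Sym}^{r-1} V$ is isomorphic to a direct summand of $\operatorname{Sym}^r V$ as a $KG$-module.
   Context: A $KG$-module $V$ is a permutation module if it has a basis $x_1,\dots,x_t$ (a permutation basis) which is invariant under the action of $G$. $\operatorname{Sym} V=\bigoplus_{i\ge 0}\operatorname{Sym}^i V$ is the symmetric algebra, identified with $K[x_1,\dots,x_t]$, with its natural $G$-action. For such $V$, take the $KG$-map $\varepsilon:V\to K$ (with $K$ the trivial module) given by $\varepsilon(x_i)=1$ for all $i$, and let $\partial=\sum_{i\le t}\partial/\partial x_i$ on $K[x_1,\dots,x_t]$; this is a $KG$-endomorphism of $\operatorname{Sym}V$. The map $\partial_r:\operatorname{Sym}^rV\to\operatorname{Sym}^{r-1}V$ is the restriction of $\partial$ to $\operatorname{Sym}^r V$. *)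

theory Defs
  imports
    "HOL-Algebra.Group"
    "HOL-Computational_Algebra.Computational_Algebra"
    "HOL-Library.Poly_Mapping"
begin

section \<open>Modules over a group algebra\<close>

text \<open>
  A \<open>KG\<close>-module, presented as a linear action of \<open>G\<close> on a \<open>K\<close>-vector space \<open>M\<close>. The field \<open>K\<close> is
  the type \<open>'k\<close> of scalars. The space \<open>M\<close> is a subspace of an ambient vector space, so that
  submodules and graded pieces are again instances; the action is only constrained on \<open>M\<close> and on
  the carrier of \<open>G\<close>.
\<close>

locale kg_module = G: group G + vector_space scale
  for G :: "'g monoid" (structure)
    and scale :: "'k::field \<Rightarrow> 'v::ab_group_add \<Rightarrow> 'v" (infixr \<open>*s\<close> 75) +
  fixes M :: "'v set"
    and act :: "'g \<Rightarrow> 'v \<Rightarrow> 'v"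
  assumes subspace_carrier: "subspace M"
    and act_closed: "\<lbrakk>g \<in> carrier G; v \<in> M\<rbrakk> \<Longrightarrow> act g v \<in> M"
    and act_add: "\<lbrakk>g \<in> carrier G; v \<in> M; w \<in> M\<rbrakk> \<Longrightarrow> act g (v + w) = act g v + act g w"
    and act_scale: "\<lbrakk>g \<in> carrier G; v \<in> M\<rbrakk> \<Longrightarrow> act g (c *s v) = c *s act g v"
    and act_one: "v \<in> M \<Longrightarrow> act \<one> v = v"
    and act_mult:
      "\<lbrakk>g \<in> carrier G; h \<in> carrier G; v \<in> M\<rbrakk> \<Longrightarrow> act (g \<otimes> h) v = act g (act h v)"

locale kg_module_hom =
  M: kg_module G scaleM M actM + N: kg_module G scaleN N actN
  for G :: "'g monoid" (structure)
    and scaleM :: "'k::field \<Rightarrow> 'v::ab_group_add \<Rightarrow> 'v" and M and actM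
    and scaleN :: "'k \<Rightarrow> 'w::ab_group_add \<Rightarrow> 'w" and N and actN +
  fixes f :: "'v \<Rightarrow> 'w"
  assumes hom_closed: "v \<in> M \<Longrightarrow> f v \<in> N"
    and hom_add: "\<lbrakk>v \<in> M; w \<in> M\<rbrakk> \<Longrightarrow> f (v + w) = f v + f w"
    and hom_scale: "v \<in> M \<Longrightarrow> f (scaleM c v) = scaleN c (f v)"
    and hom_act: "\<lbrakk>g \<in> carrier G; v \<in> M\<rbrakk> \<Longrightarrow> f (actM g v) = actN g (f v)"

definition kg_isomorphic ::
  "'g monoid \<Rightarrow> ('k::field \<Rightarrow> 'v::ab_group_add \<Rightarrow> 'v) \<Rightarrow> 'v set \<Rightarrow> ('g \<Rightarrow> 'v \<Rightarrow> 'v) \<Rightarrow>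
   ('k \<Rightarrow> 'w::ab_group_add \<Rightarrow> 'w) \<Rightarrow> 'w set \<Rightarrow> ('g \<Rightarrow> 'w \<Rightarrow> 'w) \<Rightarrow> bool" where
  "kg_isomorphic G scaleM M actM scaleN N actN \<longleftrightarrow>
     (\<exists>f. kg_module_hom G scaleM M actM scaleN N actN f \<and> bij_betw f M N)"

definition kg_direct_summand ::
  "'g monoid \<Rightarrow> ('k::field \<Rightarrow> 'v::ab_group_add \<Rightarrow> 'v) \<Rightarrow> ('g \<Rightarrow> 'v \<Rightarrow> 'v) \<Rightarrow> 'v set \<Rightarrow> 'v set \<Rightarrow> bool"
where
  "kg_direct_summand G scale act U M \<longleftrightarrow>
     kg_module G scale M act \<and> kg_module G scale U act \<and>
     (\<exists>W. kg_module G scale W act \<and> U \<inter> W = {0} \<and> M = {u + w |u w. u \<in> U \<and> w \<in> W})"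

definition (in kg_module) permutation_basis :: "'v set \<Rightarrow> bool" where
  "permutation_basis B \<longleftrightarrow>
     independent B \<and> span B = M \<and> (\<forall>g\<in>carrier G. \<forall>b\<in>B. act g b \<in> B)"


section \<open>The symmetric algebra\<close>

text \<open>
  Given a finite basis \<open>B\<close> of \<open>V\<close>, the symmetric algebra of \<open>V\<close> is identified with the polynomial
  ring over \<open>K\<close> whose variables are the elements of \<open>B\<close>. Polynomials are finitely supported
  functions from monomials to \<open>K\<close>, and monomials finitely supported exponent functions. The variables
  of the ambient type of polynomials range over all of \<open>'v\<close>, so membership in the symmetric
  algebra requires that only elements of \<open>B\<close> occur.
\<close>

type_synonym ('v, 'k) poly_on = "('v \<Rightarrow>\<^sub>0 nat) \<Rightarrow>\<^sub>0 'k"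

definition poly_const :: "'k::comm_ring_1 \<Rightarrow> ('v, 'k) poly_on" where
  "poly_const c = Poly_Mapping.single 0 c"

definition poly_var :: "'v \<Rightarrow> ('v, 'k::comm_ring_1) poly_on" where
  "poly_var b = Poly_Mapping.single (Poly_Mapping.single b 1) 1"

definition poly_scale :: "'k::comm_ring_1 \<Rightarrow> ('v, 'k) poly_on \<Rightarrow> ('v, 'k) poly_on" where
  "poly_scale c q = poly_const c * q"

definition mon_degree :: "('v \<Rightarrow>\<^sub>0 nat) \<Rightarrow> nat" where
  "mon_degree m = (\<Sum>b\<in>Poly_Mapping.keys m. Poly_Mapping.lookup m b)"

definition Sym :: "'v set \<Rightarrow> nat \<Rightarrow> ('v, 'k::comm_ring_1) poly_on set" where
  "Sym B r = {q. \<forall>m\<in>Poly_Mapping.keys q. Poly_Mapping.keys m \<subseteq> B \<and> mon_degree m = r}"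

text \<open>
  The natural action: \<open>g\<close> acts as the \<open>K\<close>-algebra endomorphism that extends its action on \<open>V\<close>, where
  \<open>V\<close> sits inside the polynomial ring as the space of linear forms.
\<close>

context kg_module
begin

definition linear_form :: "'v set \<Rightarrow> 'v \<Rightarrow> ('v, 'k) poly_on" where
  "linear_form B v = (\<Sum>b\<in>B. poly_scale (representation B v b) (poly_var b))"

definition Sym_act :: "'v set \<Rightarrow> 'g \<Rightarrow> ('v, 'k) poly_on \<Rightarrow> ('v, 'k) poly_on" where
  "Sym_act B g q =
     (\<Sum>m\<in>Poly_Mapping.keys q. poly_scale (Poly_Mapping.lookup q m)
        (\<Prod>b\<in>Poly_Mapping.keys m. linear_form B (act g b) ^ Poly_Mapping.lookup m b))"

end

text \<open>
  In the partial derivative, the truncated exponent \<open>m - single b 1\<close> for a monomial \<open>m\<close> not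
  containing \<open>b\<close> is harmless, as its coefficient vanishes.
\<close>

definition poly_partial :: "'v \<Rightarrow> ('v, 'k::comm_ring_1) poly_on \<Rightarrow> ('v, 'k) poly_on" where
  "poly_partial b q =
     (\<Sum>m\<in>Poly_Mapping.keys q. Poly_Mapping.single (m - Poly_Mapping.single b 1)
        (of_nat (Poly_Mapping.lookup m b) * Poly_Mapping.lookup q m))"

definition Sym_diff :: "'v set \<Rightarrow> ('v, 'k::comm_ring_1) poly_on \<Rightarrow> ('v, 'k) poly_on" where
  "Sym_diff B q = (\<Sum>b\<in>B. poly_partial b q)"

end

theory Submission
  imports Defs
begin

text \<open>
  Let \<open>x\<^sub>b\<close> be a variable and \<open>n = r - 1\<close>. Integration with respect to \<open>x\<^sub>b\<close>, in the coordinates given by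
  \<open>x\<^sub>b\<close> and the differences \<open>x\<^sub>c - x\<^sub>b\<close>, is a section \<open>I\<^sub>b\<close> of \<open>\<partial>\<close> in degree \<open>n\<close>, and it exists because \<open>r!\<close>
  is invertible in \<open>K\<close>. It is not \<open>G\<close>-equivariant, but \<open>g\<close> carries \<open>I\<^sub>b\<close> to the section of the variable
  \<open>g b\<close>. By Euler's identity \<open>f = n\<^sup>-\<^sup>1 \<Sum>\<^sub>b x\<^sub>b \<partial>f/\<partial>x\<^sub>b\<close> for \<open>f\<close> of degree \<open>n \<ge> 1\<close>, so
  \<open>f \<mapsto> n\<^sup>-\<^sup>1 \<Sum>\<^sub>b I\<^sub>b (x\<^sub>b \<partial>f/\<partial>x\<^sub>b)\<close> is a section as well, and it commutes with \<open>G\<close>.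
\<close>

section \<open>Linear maps given on monomials\<close>

text \<open>\<open>poly_partial\<close> and \<open>Sym_act\<close> both have this shape, so their
  linearity is proved once, here.\<close>

definition lin_ext :: "(('v \<Rightarrow>\<^sub>0 nat) \<Rightarrow> ('w, 'k) poly_on) \<Rightarrow> ('v, 'k::comm_ring_1) poly_on \<Rightarrow> ('w, 'k) poly_on"
  where "lin_ext F q = (\<Sum>m\<in>Poly_Mapping.keys q. poly_const (Poly_Mapping.lookup q m) * F m)"

lemma poly_const_0 [simp]: "poly_const 0 = 0"
  and poly_const_1 [simp]: "poly_const 1 = 1"
  and poly_const_add: "poly_const (a + b) = poly_const a + poly_const b"
  and poly_const_mult: "poly_const (a * b) = poly_const a * poly_const b"
  by (simp_all add: poly_const_def single_add mult_single)

lemma poly_const_of_nat: "poly_const (of_nat n) = of_nat n"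
  by (induction n) (simp_all add: poly_const_add)

lemma poly_const_mult_single:
  "poly_const c * Poly_Mapping.single m d = Poly_Mapping.single m (c * d)"
  by (simp add: poly_const_def mult_single)

lemma lookup_poly_const_mult:
  "Poly_Mapping.lookup (poly_const c * q) m = c * Poly_Mapping.lookup q m"
  unfolding poly_const_def mult_map_scale_conv_mult [symmetric]
  by (simp add: Poly_Mapping.map.rep_eq when_def)

lemma lin_ext_add: "lin_ext F (f + g) = lin_ext F f + lin_ext F g"
  unfolding lin_ext_def by (rule setsum_keys_plus_distrib) (simp_all add: poly_const_add distrib_right)

lemma lin_ext_const_mult: "lin_ext F (poly_const c * q) = poly_const c * lin_ext F q"
proof -
  have "lin_ext F (poly_const c * q) =
      (\<Sum>m\<in>Poly_Mapping.keys q. poly_const (Poly_Mapping.lookup (poly_const c * q) m) * F m)"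
    \<comment> \<open>Multiplying by \<open>c\<close> may kill coefficients and shrink the set of
      keys; the lost monomials contribute 0.\<close>
    unfolding lin_ext_def by (rule sum.mono_neutral_left) (auto simp: in_keys_iff lookup_poly_const_mult)
  then show ?thesis
    by (simp add: lin_ext_def lookup_poly_const_mult poly_const_mult sum_distrib_left mult.assoc)
qed

lemma lin_ext_single: "lin_ext F (Poly_Mapping.single m c) = poly_const c * F m"
  by (simp add: lin_ext_def)

lemma lin_ext_0 [simp]: "lin_ext F 0 = 0"
  by (simp add: lin_ext_def)

lemma lin_ext_sum: "lin_ext F (sum f A) = (\<Sum>a\<in>A. lin_ext F (f a))"
  by (induction A rule: infinite_finite_induct) (simp_all add: lin_ext_add)

lemma poly_eq_sum_singles:
  "q = (\<Sum>m\<in>Poly_Mapping.keys q. Poly_Mapping.single m (Poly_Mapping.lookup q m))"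
  by (rule poly_mapping_eqI) (auto simp: lookup_sum lookup_single when_def sum.delta' in_keys_iff)

lemma poly_var_mult_single:
  "poly_var b * Poly_Mapping.single m c = Poly_Mapping.single (m + Poly_Mapping.single b 1) c"
  by (simp add: poly_var_def mult_single add.commute)

lemma lin_ext_var_mult:
  assumes "\<And>m. m \<in> Poly_Mapping.keys q \<Longrightarrow> F (m + Poly_Mapping.single b 1) = G m"
  shows "lin_ext F (poly_var b * q) = lin_ext G q"
proof -
  have "lin_ext F (poly_var b * q) = lin_ext F
      (\<Sum>m\<in>Poly_Mapping.keys q. Poly_Mapping.single (m + Poly_Mapping.single b 1) (Poly_Mapping.lookup q m))"
    by (subst poly_eq_sum_singles [of q]) (simp only: sum_distrib_left poly_var_mult_single)
  also have "\<dots> = lin_ext G q"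
    using assms by (simp add: lin_ext_sum lin_ext_single lin_ext_def [of G])
  finally show ?thesis .
qed

section \<open>Homogeneous polynomials\<close>

lemma mon_degree_superset:
  assumes "finite A" "Poly_Mapping.keys m \<subseteq> A"
  shows "mon_degree m = (\<Sum>b\<in>A. Poly_Mapping.lookup m b)"
  unfolding mon_degree_def using assms by (intro sum.mono_neutral_left) (auto simp: in_keys_iff)

lemma mon_degree_add: "mon_degree (m + n) = mon_degree m + mon_degree n"
  using mon_degree_superset [of "Poly_Mapping.keys m \<union> Poly_Mapping.keys n"] Poly_Mapping.keys_add [of m n]
  by (simp add: lookup_add sum.distrib)

lemma mon_degree_single [simp]: "mon_degree (Poly_Mapping.single b n) = n"
  by (simp add: mon_degree_def)

lemma mon_degree_0_iff: "mon_degree m = 0 \<longleftrightarrow> m = 0"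
proof
  assume "mon_degree m = 0"
  then have "\<forall>b\<in>Poly_Mapping.keys m. Poly_Mapping.lookup m b = 0"
    by (simp add: mon_degree_def)
  then show "m = 0" by (intro poly_mapping_eqI) (auto simp: in_keys_iff)
qed (simp add: mon_degree_def)

text \<open>Natural exponents cannot cancel, hence equality and not just inclusion.\<close>

lemma keys_add_nat:
  fixes m n :: "'v \<Rightarrow>\<^sub>0 nat"
  shows "Poly_Mapping.keys (m + n) = Poly_Mapping.keys m \<union> Poly_Mapping.keys n"
  by (auto simp: in_keys_iff lookup_add)

lemma Sym_0 [simp]: "0 \<in> Sym B r"
  by (simp add: Sym_def)

lemma Sym_add: "f \<in> Sym B r \<Longrightarrow> g \<in> Sym B r \<Longrightarrow> f + g \<in> Sym B r"
  using Poly_Mapping.keys_add [of f g] by (auto simp: Sym_def)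

lemma Sym_sum: "(\<And>a. a \<in> A \<Longrightarrow> f a \<in> Sym B r) \<Longrightarrow> sum f A \<in> Sym B r"
  by (induction A rule: infinite_finite_induct) (simp_all add: Sym_add)

lemma Sym_const [simp]: "poly_const c \<in> Sym B 0"
  by (simp add: Sym_def poly_const_def mon_degree_def)

lemma Sym_const_mult: "f \<in> Sym B r \<Longrightarrow> poly_const c * f \<in> Sym B r"
  by (auto simp: Sym_def in_keys_iff lookup_poly_const_mult)

lemma Sym_var_mult:
  assumes "b \<in> B" "f \<in> Sym B r"
  shows "poly_var b * f \<in> Sym B (Suc r)"
proof -
  have "poly_var b * f =
      (\<Sum>m\<in>Poly_Mapping.keys f. Poly_Mapping.single (m + Poly_Mapping.single b 1) (Poly_Mapping.lookup f m))"
    by (subst poly_eq_sum_singles [of f]) (simp only: sum_distrib_left poly_var_mult_single)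
  also have "\<dots> \<in> Sym B (Suc r)"
    using assms by (intro Sym_sum) (auto simp: Sym_def mon_degree_add keys_add_nat)
  finally show ?thesis .
qed

lemma Sym_var_power_mult:
  "b \<in> B \<Longrightarrow> f \<in> Sym B r \<Longrightarrow> poly_var b ^ j * f \<in> Sym B (r + j)"
  by (induction j) (auto simp: mult.assoc intro: Sym_var_mult)

text \<open>Every monomial arises from 1 by multiplying with variables. All operators below obey a
  simple rule on \<open>poly_var b * f\<close>, so this induction reduces identities between them to
  that rule.\<close>

lemma Sym_induct [consumes 1, case_names zero const add var]:
  fixes q :: "('v, 'k::comm_ring_1) poly_on"
  assumes "q \<in> Sym B r"
    and zero: "\<And>r. P r 0"
    and const: "\<And>c. P 0 (poly_const c)"
    and add: "\<And>r f g. f \<in> Sym B r \<Longrightarrow> g \<in> Sym B r \<Longrightarrow> P r f \<Longrightarrow> P r g \<Longrightarrow> P r (f + g)"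
    and var: "\<And>r b f. b \<in> B \<Longrightarrow> f \<in> Sym B r \<Longrightarrow> P r f \<Longrightarrow> P (Suc r) (poly_var b * f)"
  shows "P r q"
proof -
  \<comment> \<open>Membership in \<open>Sym B r\<close> is carried along because \<open>var\<close>
    asks for it.\<close>
  have single: "P r (Poly_Mapping.single m c) \<and> Poly_Mapping.single m c \<in> Sym B r"
    if "mon_degree m = r" "Poly_Mapping.keys m \<subseteq> B" for m r and c :: 'k
    using that
  proof (induction r arbitrary: m)
    case 0
    then show ?case
      using const [of c] Sym_const [of c B] by (simp add: mon_degree_0_iff poly_const_def)
  next
    case (Suc r)
    then have "Poly_Mapping.keys m \<noteq> {}" by (auto simp: mon_degree_def)
    then obtain b where b: "b \<in> Poly_Mapping.keys m" by blast
    \<comment> \<open>As \<open>b\<close> occurs in \<open>m\<close>, the truncated subtraction is a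
      true one.\<close>
    define n where "n = m - Poly_Mapping.single b 1"
    have m: "m = n + Poly_Mapping.single b 1"
      using b by (intro poly_mapping_eqI)
        (auto simp: n_def lookup_add lookup_minus lookup_single when_def in_keys_iff)
    have "mon_degree n = r" "Poly_Mapping.keys n \<subseteq> B" "b \<in> B"
      using Suc.prems b by (auto simp: m mon_degree_add keys_add_nat)
    note n = this
    show ?case
      unfolding m poly_var_mult_single [symmetric]
      using Suc.IH [OF n(1,2), THEN conjunct1] Suc.IH [OF n(1,2), THEN conjunct2]
      by (intro conjI var Sym_var_mult n(3))
  qed
  \<comment> \<open>Arbitrary subsets of the keys allow an induction over finite sets;
    \<open>add\<close> again requires membership in \<open>Sym B r\<close>.\<close>
  have "P r (\<Sum>m\<in>A. Poly_Mapping.single m (Poly_Mapping.lookup q m)) \<and>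
      (\<Sum>m\<in>A. Poly_Mapping.single m (Poly_Mapping.lookup q m)) \<in> Sym B r"
    if "A \<subseteq> Poly_Mapping.keys q" for A
    using finite_subset [OF that finite_keys] that
  proof (induction A rule: finite_induct)
    case (insert m A)
    then have "mon_degree m = r" "Poly_Mapping.keys m \<subseteq> B"
      using assms(1) by (auto simp: Sym_def)
    then have "P r (Poly_Mapping.single m (Poly_Mapping.lookup q m))"
      "Poly_Mapping.single m (Poly_Mapping.lookup q m) \<in> Sym B r"
      using single [of m r "Poly_Mapping.lookup q m"] by simp_all
    then show ?case
      using insert.IH insert.hyps insert.prems by (auto intro: add Sym_add)
  qed (simp add: zero)
  from this [OF order_refl] show ?thesis
    by (simp only: poly_eq_sum_singles [symmetric])
qed

section \<open>Derivatives\<close>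

lemma poly_partial_eq_lin_ext:
  "poly_partial b = lin_ext (\<lambda>m. Poly_Mapping.single (m - Poly_Mapping.single b 1)
     (of_nat (Poly_Mapping.lookup m b)))"
  by (rule ext) (simp add: poly_partial_def lin_ext_def poly_const_mult_single mult.commute)

lemma poly_partial_add: "poly_partial b (f + g) = poly_partial b f + poly_partial b g"
  unfolding poly_partial_eq_lin_ext by (rule lin_ext_add)

lemma poly_partial_const_mult: "poly_partial b (poly_const c * f) = poly_const c * poly_partial b f"
  unfolding poly_partial_eq_lin_ext by (rule lin_ext_const_mult)

lemma poly_partial_0 [simp]: "poly_partial b 0 = 0"
  by (simp add: poly_partial_def)

lemma poly_partial_const [simp]: "poly_partial b (poly_const c) = 0"
  by (simp add: poly_partial_def poly_const_def)

text \<open>The Leibniz rule for a factor that is a variable; both sides are additive in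
  \<open>f\<close>, so monomials suffice.\<close>

lemma poly_partial_var_mult:
  "poly_partial b (poly_var c * f) = (if b = c then f else 0) + poly_var c * poly_partial b f"
proof -
  have *: "poly_partial b (poly_var c * Poly_Mapping.single m a) =
      (if b = c then Poly_Mapping.single m a else 0) + poly_var c * poly_partial b (Poly_Mapping.single m a)"
    for m a
  \<comment> \<open>If \<open>b\<close> occurs in \<open>m\<close>, subtracting
    \<open>single b 1\<close> commutes with adding \<open>single c 1\<close>. Otherwise the
    derivative of the monomial \<open>m\<close> vanishes and only \<open>b = c\<close>
    contributes.\<close>
  proof (cases "b \<in> Poly_Mapping.keys m")
    case True
    define n where "n = m - Poly_Mapping.single b 1"
    have m: "m = n + Poly_Mapping.single b 1"
      using True by (intro poly_mapping_eqI)
        (auto simp: n_def lookup_add lookup_minus lookup_single when_def in_keys_iff)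
    have "m + Poly_Mapping.single c 1 - Poly_Mapping.single b 1 = n + Poly_Mapping.single c 1"
      unfolding m by (intro poly_mapping_eqI) (auto simp: lookup_add lookup_minus lookup_single)
    then show ?thesis
      unfolding poly_var_mult_single poly_partial_eq_lin_ext lin_ext_single poly_const_mult_single
      by (auto simp: n_def [symmetric, simplified] lookup_add lookup_single single_add [symmetric] m [symmetric] distrib_left ac_simps)
  next
    case False
    then show ?thesis
      unfolding poly_var_mult_single poly_partial_eq_lin_ext lin_ext_single poly_const_mult_single
      by (auto simp: lookup_add lookup_single in_keys_iff when_def)
  qed
  have sums: "poly_partial b (\<Sum>m\<in>A. g m) = (\<Sum>m\<in>A. poly_partial b (g m))" for A and g :: "_ \<Rightarrow> ('a, 'b) poly_on"
    by (induction A rule: infinite_finite_induct) (simp_all add: poly_partial_add)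
  let ?s = "\<Sum>m\<in>Poly_Mapping.keys f. Poly_Mapping.single m (Poly_Mapping.lookup f m)"
  have "poly_partial b (poly_var c * ?s) = (if b = c then ?s else 0) + poly_var c * poly_partial b ?s"
    unfolding sum_distrib_left sums * by (simp add: sum.distrib)
  then show ?thesis
    by (simp only: poly_eq_sum_singles [symmetric])
qed

text \<open>The second conjunct serves the induction: for \<open>r = 0\<close> the term
  \<open>poly_var c * poly_partial b f\<close> has the right degree only because it is 0.\<close>

lemma poly_partial_closed_aux:
  "f \<in> Sym B r \<Longrightarrow> poly_partial b f \<in> Sym B (r - 1) \<and> (r = 0 \<longrightarrow> poly_partial b f = 0)"
proof (induction rule: Sym_induct)
  case (var r c f)
  show ?case
  proof (cases r)
    case 0
    then show ?thesis using var by (simp add: poly_partial_var_mult)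
  next
    case (Suc s)
    then show ?thesis using var Sym_var_mult [of c B "poly_partial b f" s]
      by (auto simp: poly_partial_var_mult intro: Sym_add)
  qed
qed (auto simp: poly_partial_add Sym_add)

lemma poly_partial_closed: "f \<in> Sym B r \<Longrightarrow> poly_partial b f \<in> Sym B (r - 1)"
  and poly_partial_Sym_0: "f \<in> Sym B 0 \<Longrightarrow> poly_partial b f = 0"
  by (erule poly_partial_closed_aux [THEN conjunct1])
    (erule poly_partial_closed_aux [THEN conjunct2, THEN mp, OF _ refl])

lemma Sym_diff_add: "Sym_diff B (f + g) = Sym_diff B f + Sym_diff B g"
  by (simp add: Sym_diff_def poly_partial_add sum.distrib)

lemma Sym_diff_const_mult: "Sym_diff B (poly_const c * f) = poly_const c * Sym_diff B f"
  by (simp add: Sym_diff_def poly_partial_const_mult sum_distrib_left)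

lemma Sym_diff_0 [simp]: "Sym_diff B 0 = 0"
  by (simp add: Sym_diff_def)

lemma Sym_diff_const [simp]: "Sym_diff B (poly_const c) = 0"
  by (simp add: Sym_diff_def)

lemma Sym_diff_sum: "Sym_diff B (sum f A) = (\<Sum>a\<in>A. Sym_diff B (f a))"
  by (induction A rule: infinite_finite_induct) (simp_all add: Sym_diff_add)

text \<open>By the Leibniz rule exactly one summand of \<partial> differentiates the factor
  \<open>poly_var b\<close>, so \<partial> sends each variable in \<open>B\<close> to 1.\<close>

lemma Sym_diff_var_mult:
  assumes "finite B" "b \<in> B"
  shows "Sym_diff B (poly_var b * f) = f + poly_var b * Sym_diff B f"
  using assms by (simp add: Sym_diff_def poly_partial_var_mult sum.distrib sum_distrib_left)

lemma Sym_diff_var_power_mult: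
  assumes "finite B" "b \<in> B"
  shows "Sym_diff B (poly_var b ^ Suc j * f) =
    of_nat (Suc j) * poly_var b ^ j * f + poly_var b ^ Suc j * Sym_diff B f"
proof (induction j)
  case (Suc j)
  have "Sym_diff B (poly_var b ^ Suc (Suc j) * f) = poly_var b ^ Suc j * f +
      poly_var b * Sym_diff B (poly_var b ^ Suc j * f)"
    unfolding power_Suc [of _ "Suc j"] mult.assoc [of "poly_var b"] Sym_diff_var_mult [OF assms] ..
  then show ?case
    unfolding Suc.IH by (simp add: distrib_left distrib_right mult.assoc mult.left_commute)
qed (simp add: Sym_diff_var_mult [OF assms])

lemma Sym_diff_closed: "f \<in> Sym B r \<Longrightarrow> Sym_diff B f \<in> Sym B (r - 1)"
  unfolding Sym_diff_def by (intro Sym_sum poly_partial_closed)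

lemma Sym_diff_funpow_closed: "f \<in> Sym B r \<Longrightarrow> (Sym_diff B ^^ j) f \<in> Sym B (r - j)"
proof (induction j)
  case (Suc j)
  then show ?case using Sym_diff_closed [of "(Sym_diff B ^^ j) f" B "r - j"] by simp
qed simp

text \<open>After \<open>r\<close> steps the degree is 0, and constants have derivative 0. This
  removes the boundary term of the telescoping sum below.\<close>

lemma Sym_diff_funpow_eq_0:
  assumes "f \<in> Sym B r"
  shows "(Sym_diff B ^^ Suc r) f = 0"
proof -
  have "(Sym_diff B ^^ r) f \<in> Sym B 0"
    using Sym_diff_funpow_closed [OF assms, of r] by simp
  from poly_partial_Sym_0 [OF this] show ?thesis
    by (simp add: Sym_diff_def [of B "(Sym_diff B ^^ r) f"])
qed

section \<open>Euler operators and Euler's identity\<close>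

abbreviation poly_euler :: "'v \<Rightarrow> ('v, 'k::comm_ring_1) poly_on \<Rightarrow> ('v, 'k) poly_on" where
  "poly_euler b f \<equiv> poly_var b * poly_partial b f"

lemma poly_euler_closed:
  "f \<in> Sym B (Suc r) \<Longrightarrow> b \<in> B \<Longrightarrow> poly_euler b f \<in> Sym B (Suc r)"
  using poly_partial_closed [of f B "Suc r" b] by (auto intro: Sym_var_mult)

lemma poly_euler_var_mult:
  "poly_euler b (poly_var c * f) = (if b = c then poly_var c * f else 0) + poly_var c * poly_euler b f"
  by (simp add: poly_partial_var_mult distrib_left mult.left_commute)

text \<open>Euler's identity: a new factor \<open>poly_var c\<close> adds one copy of the
  polynomial, through the summand \<open>b = c\<close>, just as it raises the degree by one.\<close>

lemma sum_poly_euler: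
  assumes "finite B" "f \<in> Sym B r"
  shows "(\<Sum>b\<in>B. poly_euler b f) = of_nat r * f"
  using assms(2)
proof (induction rule: Sym_induct)
  case (var r c f)
  have "(\<Sum>b\<in>B. poly_euler b (poly_var c * f)) =
      poly_var c * f + poly_var c * (\<Sum>b\<in>B. poly_euler b f)"
    using assms(1) var(1) by (simp add: poly_euler_var_mult sum.distrib sum_distrib_left)
  then show ?case
    unfolding var(3) of_nat_Suc distrib_left distrib_right mult_1_left
    by (simp only: mult.left_commute)
qed (simp_all add: poly_partial_add sum.distrib distrib_left)


section \<open>Splitting the total derivative\<close>

text \<open>
  In the coordinates \<open>x\<^sub>b\<close> and \<open>x\<^sub>c - x\<^sub>b\<close>, the total derivative is \<open>\<partial>/\<partial>x\<^sub>b\<close>. Iterated integration by parts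
  gives the following formula for integration in degree at most \<open>n\<close>.
\<close>

definition Sym_integral ::
  "'v set \<Rightarrow> nat \<Rightarrow> 'v \<Rightarrow> ('v, 'k::field) poly_on \<Rightarrow> ('v, 'k) poly_on" where
  "Sym_integral B n b f =
     (\<Sum>j\<le>n. poly_const ((-1) ^ j / of_nat (fact (Suc j))) * (poly_var b ^ Suc j * (Sym_diff B ^^ j) f))"

text \<open>The number \<open>n\<close> is both the divisor from Euler's identity and the truncation
  bound of the integral. Summing over all of \<open>B\<close> lets the group permute the
  summands.\<close>

definition Sym_section :: "'v set \<Rightarrow> nat \<Rightarrow> ('v, 'k::field) poly_on \<Rightarrow> ('v, 'k) poly_on" where
  "Sym_section B n f =
     poly_const (1 / of_nat n) * (\<Sum>b\<in>B. Sym_integral B n b (poly_euler b f))"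

lemma Sym_diff_funpow_add:
  "(Sym_diff B ^^ j) (f + g) = (Sym_diff B ^^ j) f + (Sym_diff B ^^ j) g"
  by (induction j) (simp_all add: Sym_diff_add)

lemma Sym_diff_funpow_const_mult:
  "(Sym_diff B ^^ j) (poly_const c * f) = poly_const c * (Sym_diff B ^^ j) f"
  by (induction j) (simp_all add: Sym_diff_const_mult)

lemma Sym_integral_add: "Sym_integral B n b (f + g) = Sym_integral B n b f + Sym_integral B n b g"
  by (simp add: Sym_integral_def Sym_diff_funpow_add distrib_left sum.distrib)

lemma Sym_integral_const_mult:
  "Sym_integral B n b (poly_const c * f) = poly_const c * Sym_integral B n b f"
  by (simp add: Sym_integral_def Sym_diff_funpow_const_mult sum_distrib_left mult.left_commute)

lemma Sym_integral_closed:
  assumes "f \<in> Sym B n" "b \<in> B"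
  shows "Sym_integral B n b f \<in> Sym B (Suc n)"
  unfolding Sym_integral_def
proof (intro Sym_sum Sym_const_mult)
  \<comment> \<open>As \<open>j \<le> n\<close>, the degrees add up:
    \<open>(n - j) + Suc j = Suc n\<close>.\<close>
  fix j assume "j \<in> {..n}"
  then show "poly_var b ^ Suc j * (Sym_diff B ^^ j) f \<in> Sym B (Suc n)"
    using Sym_var_power_mult [OF assms(2) Sym_diff_funpow_closed [OF assms(1)], of "Suc j" j] by simp
qed

text \<open>Such a \<open>k\<close> divides \<open>fact n\<close>. The characteristic enters the
  construction only through a factorial being nonzero in the field.\<close>

lemma of_nat_neq_0_if_fact:
  assumes "of_nat (fact n) \<noteq> (0::'a::semiring_1)" "0 < k" "k \<le> n"
  shows "of_nat k \<noteq> (0::'a)"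
proof -
  obtain l where "fact n = k * l"
    using dvd_fact [of k n] assms(2,3) by (auto elim: dvdE)
  then show ?thesis using assms(1) by auto
qed

text \<open>By the power rule, the derivative of summand \<open>j\<close> is
  \<open>T j - T (Suc j)\<close>. The sum telescopes to \<open>T 0 = f\<close>, as
  \<open>T (Suc n)\<close> contains the vanishing derivative of order \<open>n + 1\<close>.\<close>

lemma Sym_diff_Sym_integral:
  fixes f :: "('v, 'k::field) poly_on"
  assumes "finite B" "b \<in> B" "f \<in> Sym B n" "of_nat (fact (Suc n)) \<noteq> (0::'k)"
  shows "Sym_diff B (Sym_integral B n b f) = f"
proof -
  define T where "T j = poly_const ((-1) ^ j / of_nat (fact j)) * (poly_var b ^ j * (Sym_diff B ^^ j) f)" for j
  have step: "Sym_diff B (poly_const ((-1) ^ j / of_nat (fact (Suc j))) * (poly_var b ^ Suc j * (Sym_diff B ^^ j) f)) =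
      T j - T (Suc j)" if "j \<le> n" for j
  proof -
    \<comment> \<open>Invertibility of \<open>j + 1\<close> lets it cancel against
      \<open>(j + 1)!\<close>, leaving \<open>1 / j!\<close>.\<close>
    have "of_nat (Suc j) \<noteq> (0::'k)"
      using of_nat_neq_0_if_fact [OF assms(4), of "Suc j"] that by simp
    then have "(-1) ^ j / of_nat (fact j) = (-1) ^ j / of_nat (fact (Suc j)) * (of_nat (Suc j) :: 'k)"
      by (simp only: fact_Suc of_nat_id of_nat_mult) (simp add: field_simps del: of_nat_Suc)
    then have c: "poly_const ((-1) ^ j / of_nat (fact j)) =
        poly_const ((-1) ^ j / of_nat (fact (Suc j)) :: 'k) * of_nat (Suc j)"
      by (simp only: poly_const_mult poly_const_of_nat)
    have "poly_const ((-1) ^ Suc j / of_nat (fact (Suc j)) :: 'k) +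
        poly_const ((-1) ^ j / of_nat (fact (Suc j))) = 0"
      unfolding poly_const_add [symmetric] by simp
    then have c': "poly_const ((-1) ^ Suc j / of_nat (fact (Suc j)) :: 'k) =
        - poly_const ((-1) ^ j / of_nat (fact (Suc j)))"
      by (rule eq_neg_iff_add_eq_0 [THEN iffD2])
    show ?thesis
      unfolding T_def c c' Sym_diff_const_mult Sym_diff_var_power_mult [OF assms(1,2)]
      by (simp only: distrib_left mult.assoc funpow.simps o_apply mult_minus_left diff_minus_eq_add)
  qed
  have "Sym_diff B (Sym_integral B n b f) = (\<Sum>j\<le>n. T j - T (Suc j))"
    unfolding Sym_integral_def Sym_diff_sum by (intro sum.cong refl step) simp
  also have "\<dots> = T 0 - T (Suc n)"
    by (rule sum_telescope)
  also have "\<dots> = f"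
    unfolding T_def Sym_diff_funpow_eq_0 [OF assms(3)] by simp
  finally show ?thesis .
qed

lemma Sym_section_closed:
  assumes "f \<in> Sym B n" "0 < n"
  shows "Sym_section B n f \<in> Sym B (Suc n)"
proof -
  from assms(2) obtain k where "n = Suc k" using gr0_conv_Suc by blast
  with assms(1) show ?thesis
    unfolding Sym_section_def
    by (auto intro!: Sym_sum Sym_const_mult Sym_integral_closed poly_euler_closed)
qed

lemma Sym_section_add: "Sym_section B n (f + g) = Sym_section B n f + Sym_section B n g"
  by (simp add: Sym_section_def poly_partial_add distrib_left Sym_integral_add sum.distrib)

lemma Sym_section_const_mult: "Sym_section B n (poly_const c * f) = poly_const c * Sym_section B n f"
  by (simp add: Sym_section_def poly_partial_const_mult mult.left_commute Sym_integral_const_mult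
      sum_distrib_left)

text \<open>\<partial> undoes each integral, and the remaining sum of Euler operators is
  \<open>n\<close> times \<open>f\<close>.\<close>

lemma Sym_diff_Sym_section:
  fixes f :: "('v, 'k::field) poly_on"
  assumes "finite B" "f \<in> Sym B n" "of_nat (fact (Suc n)) \<noteq> (0::'k)" "0 < n"
  shows "Sym_diff B (Sym_section B n f) = f"
proof -
  from assms(4) obtain k where k: "n = Suc k" using gr0_conv_Suc by blast
  have n: "of_nat n \<noteq> (0::'k)" using of_nat_neq_0_if_fact [OF assms(3), of n] assms(4) by simp
  have "Sym_diff B (Sym_section B n f) = poly_const (1 / of_nat n) * (\<Sum>b\<in>B. poly_euler b f)"
    unfolding Sym_section_def Sym_diff_const_mult Sym_diff_sum
    using assms poly_euler_closed [of f B k] by (simp add: Sym_diff_Sym_integral k)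
  also have "\<dots> = poly_const (1 / of_nat n * of_nat n) * f"
    unfolding sum_poly_euler [OF assms(1,2)] poly_const_mult poly_const_of_nat by (simp only: mult.assoc)
  finally show ?thesis using n by simp
qed

section \<open>The action on the symmetric algebra\<close>

lemma vector_space_poly_scale: "vector_space (poly_scale :: 'k::field \<Rightarrow> ('v, 'k) poly_on \<Rightarrow> _)"
  by unfold_locales (simp_all add: poly_scale_def poly_const_add poly_const_mult algebra_simps)

lemma subspace_Sym: "module.subspace (poly_scale :: 'k::field \<Rightarrow> _) (Sym B r :: ('v, 'k) poly_on set)"
proof -
  interpret vector_space "poly_scale :: 'k \<Rightarrow> ('v, 'k) poly_on \<Rightarrow> _"
    by (rule vector_space_poly_scale)
  show ?thesis
    by (rule subspaceI) (simp_all add: Sym_add poly_scale_def Sym_const_mult)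
qed

context kg_module
begin

lemma Sym_act_eq_lin_ext:
  "Sym_act B g = lin_ext (\<lambda>m. \<Prod>b\<in>Poly_Mapping.keys m. linear_form B (act g b) ^ Poly_Mapping.lookup m b)"
  by (rule ext) (simp add: Sym_act_def lin_ext_def poly_scale_def)

lemma Sym_act_add: "Sym_act B g (f + h) = Sym_act B g f + Sym_act B g h"
  unfolding Sym_act_eq_lin_ext by (rule lin_ext_add)

lemma Sym_act_const_mult: "Sym_act B g (poly_const c * f) = poly_const c * Sym_act B g f"
  unfolding Sym_act_eq_lin_ext by (rule lin_ext_const_mult)

lemma Sym_act_0 [simp]: "Sym_act B g 0 = 0"
  unfolding Sym_act_eq_lin_ext by simp

lemma Sym_act_const [simp]: "Sym_act B g (poly_const c) = poly_const c"
  unfolding Sym_act_eq_lin_ext by (subst (1) poly_const_def) (simp add: lin_ext_single)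

lemma Sym_act_sum: "Sym_act B g (sum f A) = (\<Sum>a\<in>A. Sym_act B g (f a))"
  by (induction A rule: infinite_finite_induct) (simp_all add: Sym_act_add)

text \<open>The part of multiplicativity that \<open>Sym_induct\<close> needs: raising the exponent
  of \<open>b\<close> by one contributes one more factor \<open>?L b\<close>.\<close>

lemma Sym_act_linear_form_mult:
  "Sym_act B g (poly_var b * f) = linear_form B (act g b) * Sym_act B g f"
proof -
  let ?L = "\<lambda>b. linear_form B (act g b)"
  let ?F = "\<lambda>m. \<Prod>b\<in>Poly_Mapping.keys m. ?L b ^ Poly_Mapping.lookup m b"
  \<comment> \<open>Exponent 0 gives the factor 1, so the products for \<open>m\<close> and
    \<open>m + single b 1\<close> can be compared over one common index set.\<close>
  have F: "?F m = (\<Prod>b\<in>A. ?L b ^ Poly_Mapping.lookup m b)"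
    if "finite A" "Poly_Mapping.keys m \<subseteq> A" for A m
    using that by (intro prod.mono_neutral_left) (auto simp: in_keys_iff)
  have "?F (m + Poly_Mapping.single b 1) = ?L b * ?F m" for m
  proof -
    let ?A = "insert b (Poly_Mapping.keys m)"
    have "?F (m + Poly_Mapping.single b 1) =
        (\<Prod>x\<in>?A. ?L x ^ Poly_Mapping.lookup (m + Poly_Mapping.single b 1) x)"
      by (rule F) (auto simp: keys_add_nat)
    also have "\<dots> = (\<Prod>x\<in>?A. (if x = b then ?L x else 1) * ?L x ^ Poly_Mapping.lookup m x)"
      by (intro prod.cong) (auto simp: lookup_add lookup_single when_def)
    also have "\<dots> = ?L b * (\<Prod>x\<in>?A. ?L x ^ Poly_Mapping.lookup m x)"
      unfolding prod.distrib by (simp add: prod.delta)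
    also have "(\<Prod>x\<in>?A. ?L x ^ Poly_Mapping.lookup m x) = ?F m"
      by (rule F [symmetric]) auto
    finally show ?thesis .
  qed
  then have "Sym_act B g (poly_var b * f) = lin_ext (\<lambda>m. ?L b * ?F m) f"
    unfolding Sym_act_eq_lin_ext by (rule lin_ext_var_mult)
  then show ?thesis
    by (simp add: Sym_act_eq_lin_ext lin_ext_def sum_distrib_left mult.left_commute)
qed

section \<open>Equivariance with respect to a permutation basis\<close>

context
  fixes B
  assumes fin: "finite B" and basis: "permutation_basis B"
begin

lemma act_basis: "g \<in> carrier G \<Longrightarrow> b \<in> B \<Longrightarrow> act g b \<in> B"
  using basis by (simp add: permutation_basis_def)

lemma basis_in_carrier: "b \<in> B \<Longrightarrow> b \<in> M"
  using basis span_base by (auto simp: permutation_basis_def)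

lemma act_inv_act: "g \<in> carrier G \<Longrightarrow> b \<in> B \<Longrightarrow> act (inv g) (act g b) = b"
  using act_mult [of "inv g" g b] by (simp add: basis_in_carrier act_one)

lemma bij_betw_act_basis:
  assumes g: "g \<in> carrier G"
  shows "bij_betw (act g) B B"
proof (rule bij_betw_byWitness [where f' = "act (inv g)"])
  show "\<forall>b\<in>B. act g (act (inv g) b) = b"
    using act_inv_act [of "inv g"] g by simp
qed (use act_inv_act act_basis g in auto)

lemma linear_form_basis:
  assumes "b \<in> B"
  shows "linear_form B b = poly_var b"
proof -
  have "linear_form B b = (\<Sum>c\<in>B. if c = b then poly_var c else 0)"
    unfolding linear_form_def poly_scale_def
    using basis assms by (intro sum.cong) (auto simp: permutation_basis_def representation_basis)
  then show ?thesis using fin assms by simp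
qed

text \<open>As \<open>act g b\<close> is again a basis vector, its linear form is a single variable:
  the group permutes the variables.\<close>

lemma Sym_act_var_mult:
  "g \<in> carrier G \<Longrightarrow> b \<in> B \<Longrightarrow> Sym_act B g (poly_var b * f) = poly_var (act g b) * Sym_act B g f"
  by (simp add: Sym_act_linear_form_mult linear_form_basis act_basis)

lemma Sym_act_var_power_mult:
  "g \<in> carrier G \<Longrightarrow> b \<in> B \<Longrightarrow>
    Sym_act B g (poly_var b ^ j * f) = poly_var (act g b) ^ j * Sym_act B g f"
  by (induction j) (simp_all add: mult.assoc Sym_act_var_mult)

lemma Sym_act_closed: "f \<in> Sym B r \<Longrightarrow> g \<in> carrier G \<Longrightarrow> Sym_act B g f \<in> Sym B r"
  by (induction rule: Sym_induct)
    (auto simp: Sym_act_add Sym_act_var_mult intro: Sym_add Sym_var_mult act_basis)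

lemma Sym_act_one: "f \<in> Sym B r \<Longrightarrow> Sym_act B \<one> f = f"
  by (induction rule: Sym_induct)
    (simp_all add: Sym_act_add Sym_act_var_mult act_one basis_in_carrier)

lemma Sym_act_mult:
  "f \<in> Sym B r \<Longrightarrow> g \<in> carrier G \<Longrightarrow> h \<in> carrier G \<Longrightarrow>
    Sym_act B (g \<otimes> h) f = Sym_act B g (Sym_act B h f)"
  by (induction rule: Sym_induct)
    (simp_all add: Sym_act_add Sym_act_var_mult act_mult basis_in_carrier act_basis)

lemma kg_module_Sym: "kg_module G poly_scale (Sym B r) (Sym_act B)"
proof -
  interpret P: vector_space "poly_scale :: 'k \<Rightarrow> ('v, 'k) poly_on \<Rightarrow> _"
    by (rule vector_space_poly_scale)
  show ?thesis
    by unfold_locales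
      (auto simp: subspace_Sym Sym_act_closed Sym_act_add poly_scale_def Sym_act_const_mult
        Sym_act_one Sym_act_mult)
qed

lemma poly_euler_Sym_act:
  assumes "f \<in> Sym B r" and g: "g \<in> carrier G" and b: "b \<in> B"
  shows "Sym_act B g (poly_euler b f) = poly_euler (act g b) (Sym_act B g f)"
  using assms(1)
proof (induction rule: Sym_induct)
  case (var r c f)
  \<comment> \<open>Injectivity of \<open>g\<close> on \<open>B\<close> makes the case distinctions
    on both sides agree.\<close>
  have "act g b = act g c \<longleftrightarrow> b = c"
    using bij_betw_act_basis [OF g] b var(1) by (auto simp: bij_betw_def inj_on_def)
  then show ?case
    unfolding poly_euler_var_mult Sym_act_add Sym_act_var_mult [OF g var(1)] var(3)
    by (simp add: Sym_act_var_mult [OF g var(1)])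
qed (simp_all add: poly_partial_add Sym_act_add distrib_left)

text \<open>The product rule for \<partial> is the same for every variable in \<open>B\<close>, so
  permuting them changes nothing.\<close>

lemma Sym_diff_Sym_act:
  assumes "f \<in> Sym B r" and g: "g \<in> carrier G"
  shows "Sym_act B g (Sym_diff B f) = Sym_diff B (Sym_act B g f)"
  using assms(1)
proof (induction rule: Sym_induct)
  case (var r c f)
  then show ?case
    using g fin by (simp add: Sym_diff_var_mult Sym_act_add Sym_act_var_mult act_basis)
qed (simp_all add: Sym_diff_add Sym_act_add)

lemma Sym_diff_funpow_Sym_act:
  assumes "f \<in> Sym B r" and g: "g \<in> carrier G"
  shows "Sym_act B g ((Sym_diff B ^^ j) f) = (Sym_diff B ^^ j) (Sym_act B g f)"
proof (induction j)
  case (Suc j)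
  then show ?case
    using Sym_diff_Sym_act [OF Sym_diff_funpow_closed [OF assms(1)] g, of j] by simp
qed simp

text \<open>The integral is built from scalars, powers of \<open>poly_var b\<close> and powers of
  \<partial>; \<open>g\<close> commutes with all but the variable, which it moves to
  \<open>act g b\<close>.\<close>

lemma Sym_integral_Sym_act:
  assumes "f \<in> Sym B r" "g \<in> carrier G" "b \<in> B"
  shows "Sym_act B g (Sym_integral B n b f) = Sym_integral B n (act g b) (Sym_act B g f)"
  unfolding Sym_integral_def Sym_act_sum Sym_act_const_mult
    Sym_act_var_power_mult [OF assms(2,3)] Sym_diff_funpow_Sym_act [OF assms(1,2)] ..

lemma Sym_section_Sym_act:
  assumes f: "f \<in> Sym B n" and "0 < n" and g: "g \<in> carrier G"
  shows "Sym_act B g (Sym_section B n f) = Sym_section B n (Sym_act B g f)"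
proof -
  from assms(2) obtain k where k: "n = Suc k" using gr0_conv_Suc by blast
  have "Sym_act B g (Sym_integral B n b (poly_euler b f)) =
      Sym_integral B n (act g b) (poly_euler (act g b) (Sym_act B g f))" if "b \<in> B" for b
    using Sym_integral_Sym_act [OF poly_euler_closed [OF f [unfolded k] that] g that]
      poly_euler_Sym_act [OF f g that] by simp
  then have "Sym_act B g (Sym_section B n f) = poly_const (1 / of_nat n) *
      (\<Sum>b\<in>B. Sym_integral B n (act g b) (poly_euler (act g b) (Sym_act B g f)))"
    by (simp add: Sym_section_def Sym_act_const_mult Sym_act_sum)
  \<comment> \<open>The sum is reindexed along the permutation of \<open>B\<close> given by
    \<open>g\<close>.\<close>
  also have "\<dots> = Sym_section B n (Sym_act B g f)"
    unfolding Sym_section_def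
    by (subst sum.reindex_bij_betw [OF bij_betw_act_basis [OF g]]) (rule refl)
  finally show ?thesis .
qed

lemma kg_module_hom_Sym_diff:
  "kg_module_hom G poly_scale (Sym B r) (Sym_act B) poly_scale (Sym B (r - 1)) (Sym_act B) (Sym_diff B)"
  by (intro kg_module_hom.intro kg_module_Sym kg_module_hom_axioms.intro)
    (simp_all only: Sym_diff_closed Sym_diff_add poly_scale_def Sym_diff_const_mult Sym_diff_Sym_act)

lemma kg_module_hom_Sym_section:
  assumes "0 < n"
  shows "kg_module_hom G poly_scale (Sym B n) (Sym_act B) poly_scale (Sym B (Suc n)) (Sym_act B)
    (Sym_section B n)"
  using assms by (intro kg_module_hom.intro kg_module_Sym kg_module_hom_axioms.intro)
    (simp_all only: Sym_section_closed Sym_section_add poly_scale_def Sym_section_const_mult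
      Sym_section_Sym_act)

end

section \<open>Submodules, and direct summands from split surjections\<close>

lemma submodule:
  assumes "subspace U" "U \<subseteq> M" "\<And>g u. g \<in> carrier G \<Longrightarrow> u \<in> U \<Longrightarrow> act g u \<in> U"
  shows "kg_module G scale U act"
proof unfold_locales
  show "subspace U" by fact
  show "act g u \<in> U" if "g \<in> carrier G" "u \<in> U" for g u
    using assms(3) that .
  show "act g (u + w) = act g u + act g w" if "g \<in> carrier G" "u \<in> U" "w \<in> U" for g u w
    using act_add that assms(2) by blast
  show "act g (c *s u) = c *s act g u" if "g \<in> carrier G" "u \<in> U" for g u c
    using act_scale that assms(2) by blast
  show "act \<one> u = u" if "u \<in> U" for u
    using act_one that assms(2) by blast
  show "act (g \<otimes> h) u = act g (act h u)" if "g \<in> carrier G" "h \<in> carrier G" "u \<in> U" for g h u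
    using act_mult that assms(2) by blast
qed

end

text \<open>The kernel of \<open>f\<close> is a complement of the image of \<open>\<phi>\<close>, by
  \<open>v = \<phi> (f v) + (v - \<phi> (f v))\<close>; and \<open>\<phi>\<close> is injective,
  having the left inverse \<open>f\<close>.\<close>

lemma split_surjection_direct_summand:
  assumes "kg_module_hom G scaleM M actM scaleN N actN f"
    and "kg_module_hom G scaleN N actN scaleM M actM \<phi>"
    and split: "\<And>v. v \<in> N \<Longrightarrow> f (\<phi> v) = v"
  shows "kg_direct_summand G scaleM actM (\<phi> ` N) M"
    and "kg_isomorphic G scaleN N actN scaleM (\<phi> ` N) actM"
proof -
  interpret f: kg_module_hom G scaleM M actM scaleN N actN f by fact
  interpret s: kg_module_hom G scaleN N actN scaleM M actM \<phi> by fact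
  note M = f.M.subspace_0 [OF f.M.subspace_carrier] f.M.subspace_add [OF f.M.subspace_carrier]
    f.M.subspace_diff [OF f.M.subspace_carrier] f.M.subspace_scale [OF f.M.subspace_carrier]
  note N = f.N.subspace_0 [OF f.N.subspace_carrier] f.N.subspace_add [OF f.N.subspace_carrier]
    f.N.subspace_diff [OF f.N.subspace_carrier] f.N.subspace_scale [OF f.N.subspace_carrier]
  have f0: "f 0 = 0" using f.hom_add [of 0 0] M(1) by simp
  have s0: "\<phi> 0 = 0" using s.hom_add [of 0 0] N(1) by simp
  have fdiff: "f (v - w) = f v - f w" if "v \<in> M" "w \<in> M" for v w
    using f.hom_add [of "v - w" w] that M(3) by (simp add: algebra_simps)
  define W where "W = {v \<in> M. f v = 0}"
  have U: "kg_module G scaleM (\<phi> ` N) actM"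
  proof (rule f.M.submodule)
    show "f.M.subspace (\<phi> ` N)"
    proof (rule f.M.subspaceI)
      show "0 \<in> \<phi> ` N" using s0 N(1) by force
      show "x + y \<in> \<phi> ` N" if "x \<in> \<phi> ` N" "y \<in> \<phi> ` N" for x y
        using that by (auto simp: s.hom_add [symmetric] N(2))
      show "scaleM c x \<in> \<phi> ` N" if "x \<in> \<phi> ` N" for c x
        using that by (auto simp: s.hom_scale [symmetric] N(4))
    qed
    show "actM g u \<in> \<phi> ` N" if "g \<in> carrier G" "u \<in> \<phi> ` N" for g u
      using that by (auto simp: s.hom_act [symmetric] f.N.act_closed)
  qed (use s.hom_closed in auto)
  have act0: "actN g 0 = 0" if "g \<in> carrier G" for g
    using f.N.act_add [OF that N(1) N(1)] by simp
  have "kg_module G scaleM W actM"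
    by (rule f.M.submodule)
      (auto simp: W_def M f0 f.hom_add f.hom_scale f.hom_act act0 f.M.act_closed intro!: f.M.subspaceI)
  \<comment> \<open>If \<open>\<phi> v\<close> lies in the kernel, then
    \<open>v = f (\<phi> v) = 0\<close>.\<close>
  moreover have "\<phi> ` N \<inter> W = {0}"
    using split s0 N(1) M(1) f0 by (force simp: W_def)
  moreover have "M = {u + w |u w. u \<in> \<phi> ` N \<and> w \<in> W}"
  proof (intro equalityI subsetI)
    fix v assume v: "v \<in> M"
    then have "v - \<phi> (f v) \<in> W" "\<phi> (f v) \<in> \<phi> ` N"
      by (simp_all add: W_def fdiff f.hom_closed s.hom_closed split M(3))
    moreover have "v = \<phi> (f v) + (v - \<phi> (f v))" by simp
    ultimately show "v \<in> {u + w |u w. u \<in> \<phi> ` N \<and> w \<in> W}" by blast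
  qed (auto simp: W_def s.hom_closed M(2))
  ultimately show "kg_direct_summand G scaleM actM (\<phi> ` N) M"
    unfolding kg_direct_summand_def using U f.M.kg_module_axioms by blast
  have "kg_module_hom G scaleN N actN scaleM (\<phi> ` N) actM \<phi>"
    using U f.N.kg_module_axioms s.hom_add s.hom_scale s.hom_act
    by (intro kg_module_hom.intro kg_module_hom_axioms.intro) auto
  moreover have "bij_betw \<phi> N (\<phi> ` N)"
    by (rule inj_on_imp_bij_betw) (metis inj_on_inverseI split)
  ultimately show "kg_isomorphic G scaleN N actN scaleM (\<phi> ` N) actM"
    unfolding kg_isomorphic_def by blast
qed

theorem corollary1p2:
  fixes G :: "'g monoid"
    and scale :: "'k::field \<Rightarrow> 'v::ab_group_add \<Rightarrow> 'v"
    and V :: "'v set"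
    and act :: "'g \<Rightarrow> 'v \<Rightarrow> 'v"
    and B :: "'v set"
    and p r :: nat
  assumes "prime p" and "CHAR('k) = p"
    and "group G" and "finite (carrier G)"
    and "kg_module G scale V act"
    and "finite B" and "kg_module.permutation_basis G scale V act B"
    and "2 \<le> r" and "r \<le> p - 1"
  shows "let S = kg_module.Sym_act scale act B;
             d = (Sym_diff B :: ('v, 'k) poly_on \<Rightarrow> ('v, 'k) poly_on)
         in kg_module_hom G poly_scale (Sym B r) S poly_scale (Sym B (r - 1)) S d \<and>
            d ` Sym B r = Sym B (r - 1) \<and>
            (\<exists>\<phi>. kg_module_hom G poly_scale (Sym B (r - 1)) S poly_scale (Sym B r) S \<phi> \<and>
                 (\<forall>q\<in>Sym B (r - 1). d (\<phi> q) = q)) \<and>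
            (\<exists>U. kg_direct_summand G poly_scale S U (Sym B r) \<and>
                 kg_isomorphic G poly_scale (Sym B (r - 1)) S poly_scale U S)"
proof -
  interpret kg_module G scale V act by fact
  define n where "n = r - 1"
  \<comment> \<open>\<open>2 \<le> r\<close> makes the source degree \<open>n\<close> positive, as
    division by \<open>n\<close> requires.\<close>
  have n: "0 < n" "r - 1 = n" "r = Suc n" using assms(8) by (auto simp: n_def)
  \<comment> \<open>A prime divides \<open>r!\<close> only if it is at most \<open>r\<close>, and
    here \<open>r < p\<close>. Hence \<open>r!\<close> is nonzero in the field.\<close>
  have "\<not> p dvd fact (Suc n)"
    using assms(1,8,9) by (simp add: prime_dvd_fact_iff n(3) del: fact_Suc)
  then have fact: "of_nat (fact (Suc n)) \<noteq> (0::'k)"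
    using assms(2) by (simp add: of_nat_eq_0_iff_char_dvd del: fact_Suc)
  let ?d = "Sym_diff B :: ('v, 'k) poly_on \<Rightarrow> ('v, 'k) poly_on"
  note d = kg_module_hom_Sym_diff [OF assms(6,7), of r, unfolded n(2)]
  note s = kg_module_hom_Sym_section [OF assms(6,7) n(1), folded n(3)]
  have split: "?d (Sym_section B n q) = q" if "q \<in> Sym B n" for q
    using Sym_diff_Sym_section [OF assms(6) that fact n(1)] .
  \<comment> \<open>The section provides preimages, which gives surjectivity.\<close>
  have "?d ` Sym B r = Sym B n"
  proof (intro equalityI subsetI)
    fix q :: "('v, 'k) poly_on" assume q: "q \<in> Sym B n"
    then have "Sym_section B n q \<in> Sym B r"
      unfolding n(3) by (rule Sym_section_closed [OF _ n(1)])
    with split [OF q] show "q \<in> ?d ` Sym B r" by (metis imageI)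
  qed (use Sym_diff_closed [of _ B r] n(2) in auto)
  then show ?thesis
    \<comment> \<open>The witness for the summand \<open>U\<close> is the image of the
      section.\<close>
    unfolding Let_def n(2) using d s split split_surjection_direct_summand [OF d s split] by blast
qed

end
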